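(* $\mathrm{VCdim}\equiv_{\mathrm{sW}}\mathrm{VCdim}^+\equiv_{\mathrm{sW}}\mathsf{SORT}$.
   Context: Weihrauch reducibility: a represented space is a set $X$ with a surjective partial map $\delta_X:\subseteq\mathbb{N}^\mathbb{N}\to X$. A problem is a partial multivalued map $f:\subseteq X\rightrightarrows Y$ between represented spaces; $F:\subseteq\mathbb{N}^\mathbb{N}\to\mathbb{N}^\mathbb{N}$ realizes $f$ if $\delta_Y F(p)\in f(\delta_X(p))$ for all $p\in\mathrm{dom}(f\circ\delta_X)$. We write $f\le_{\mathrm{sW}}g$ if there are computable $H,K:\subseteq\mathbb{N}^\mathbb{N}\to\mathbb{N}^\mathbb{N}$ such that $HGK$ realizes $f$ whenever $G$ realizes $g$; $\equiv_{\mathrm{sW}}$ is the induced equivalence. Closed sets: fix a computable bijective enumeration $n\mapsto w_n$ of $\{0,1\}^*$ and let $B_n=w_n2^\mathbb{N}$. $\mathcal{A}_+$ is the set of closed subsets of Cantor space $2^\mathbb{N}$ where $p$ names $A$ iff $\{n:n+1\in\mathrm{range}(p)\}=\{n:B_n\cap A\neq\emptyset\}$; $\mathcal{A}_-$ is the same set where $p$ names $2^\mathbb{N}\setminus\bigcup_{n+1\in\mathrm{range}(p)}B_n$; $\mathcal{A}$ is the same set where $\langle p,q\rangle$ names $A$ iff $p$ names $A$ in $\mathcal{A}_+$ and $q$ names $A$ in $\mathcal{A}_-$ ($\langle\cdot,\cdot\rangle$ a standard pairing on Baire space). VC dimension: elements of $2^\mathbb{N}$ are identified with subsets of $\mathbb{N}$.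 For $\mathcal{C}\subseteq 2^\mathbb{N}$ and finite $A\subseteq\mathbb{N}$, $A$ is shattered by $\mathcal{C}$ if $|\{B\cap A:B\in\mathcal{C}\}|=2^{|A|}$; $\mathrm{VCdim}(\mathcal{C})=\sup\{|A|:A$ finite and shattered by $\mathcal{C}\}\in\mathbb{N}\cup\{\infty\}$ for nonempty $\mathcal{C}$, and $\mathrm{VCdim}(\emptyset)=0$. $\mathbb{N}_\infty=\mathbb{N}\cup\{\infty\}$ is represented by $0^n1p\mapsto n$ ($p\in\mathbb{N}^\mathbb{N}$) and $\widehat{0}\mapsto\infty$ ($\widehat{0}$ the constant zero sequence). $\mathrm{VCdim}:\mathcal{A}\to\mathbb{N}_\infty$ and $\mathrm{VCdim}^+:\mathcal{A}_+\to\mathbb{N}_\infty$ are the map $\mathcal{C}\mapsto\mathrm{VCdim}(\mathcal{C})$ on the respective input spaces. $\mathsf{SORT}:2^\mathbb{N}\to2^\mathbb{N}$ maps $p$ to $\widehat{0}$ if $p$ contains infinitely many zeros and to $0^n\widehat{1}$ if $p$ contains exactly $n$ zeros. *)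

theory Defs
  imports "HOL-Analysis.Analysis" "HOL-Library.Extended_Nat"
begin

type_synonym baire = "nat \<Rightarrow> nat"
type_synonym cantor = "nat \<Rightarrow> bool"


section \<open>Computability on Baire space\<close>

text \<open>
  Computable functions on Baire space are those given by Turing functionals, here presented as
  \<open>\<mu>\<close>-recursive functions relative to an oracle: the \<open>n\<close>-th entry of the output is computed from
  \<open>n\<close> by one fixed program that may query the input \<open>p\<close>.  \<open>run p e xs y\<close> means that
  program \<open>e\<close> with oracle \<open>p\<close> halts on the arguments \<open>xs\<close> with result \<open>y\<close>.
\<close>

datatype prog =
    Zero
  | Succ
  | Proj nat
  | Oracle
  | Comp prog "prog list"
  | PrimRec prog prog
  | Mu prog

inductive run :: "baire \<Rightarrow> prog \<Rightarrow> nat list \<Rightarrow> nat \<Rightarrow> bool" for p :: baire where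
  run_Zero: "run p Zero xs 0"
| run_Succ: "run p Succ [x] (Suc x)"
| run_Proj: "i < length xs \<Longrightarrow> run p (Proj i) xs (xs ! i)"
| run_Oracle: "run p Oracle [x] (p x)"
| run_Comp: "list_all2 (\<lambda>g y. run p g xs y) gs ys \<Longrightarrow> run p f ys z \<Longrightarrow> run p (Comp f gs) xs z"
| run_PrimRec_0: "run p f xs y \<Longrightarrow> run p (PrimRec f g) (0 # xs) y"
| run_PrimRec_Suc: "run p (PrimRec f g) (n # xs) r \<Longrightarrow> run p g (r # n # xs) y
    \<Longrightarrow> run p (PrimRec f g) (Suc n # xs) y"
| run_Mu: "run p f (n # xs) 0 \<Longrightarrow> (\<forall>m<n. \<exists>k. run p f (m # xs) (Suc k)) \<Longrightarrow> run p (Mu f) xs n"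

definition computable :: "(baire \<rightharpoonup> baire) \<Rightarrow> bool" where
  "computable F \<longleftrightarrow> (\<exists>e. \<forall>p q. F p = Some q \<longrightarrow> (\<forall>n. run p e [n] (q n)))"


section \<open>Represented spaces, problems and strong Weihrauch reducibility\<close>

text \<open>
  A represented space is given by its representation \<open>\<delta> :: baire \<rightharpoonup> 'x\<close>, the underlying set
  being \<open>ran \<delta>\<close>.  A partial multivalued map is a set-valued function, undefined where its value
  is empty; its values outside \<open>ran\<close> of the input representation are irrelevant.
\<close>

record ('x, 'y) problem =
  in_rep :: "baire \<rightharpoonup> 'x"
  out_rep :: "baire \<rightharpoonup> 'y"
  mv :: "'x \<Rightarrow> 'y set"

definition realizes :: "(baire \<rightharpoonup> baire) \<Rightarrow> ('x, 'y) problem \<Rightarrow> bool" where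
  "realizes F f \<longleftrightarrow> (\<forall>p x. in_rep f p = Some x \<and> mv f x \<noteq> {} \<longrightarrow>
     (\<exists>q y. F p = Some q \<and> out_rep f q = Some y \<and> y \<in> mv f x))"

definition sW_le :: "('x, 'y) problem \<Rightarrow> ('u, 'v) problem \<Rightarrow> bool"  (infix \<open>\<le>\<^sub>s\<^sub>W\<close> 50) where
  "f \<le>\<^sub>s\<^sub>W g \<longleftrightarrow> (\<exists>H K. computable H \<and> computable K \<and>
     (\<forall>G. realizes G g \<longrightarrow> realizes (H \<circ>\<^sub>m G \<circ>\<^sub>m K) f))"

definition sW_equiv :: "('x, 'y) problem \<Rightarrow> ('u, 'v) problem \<Rightarrow> bool"  (infix \<open>\<equiv>\<^sub>s\<^sub>W\<close> 50) where
  "f \<equiv>\<^sub>s\<^sub>W g \<longleftrightarrow> f \<le>\<^sub>s\<^sub>W g \<and> g \<le>\<^sub>s\<^sub>W f"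

text \<open>The partial map given by a naming relation \<open>N\<close> (``\<open>p\<close> names \<open>x\<close>''), where each \<open>p\<close>
  names at most one \<open>x\<close>.\<close>

definition rep_of :: "(baire \<Rightarrow> 'x \<Rightarrow> bool) \<Rightarrow> (baire \<rightharpoonup> 'x)" where
  "rep_of N p = (if \<exists>x. N p x then Some (THE x. N p x) else None)"

lemma rep_of_eq_Some_iff:
  assumes "\<And>p x y. N p x \<Longrightarrow> N p y \<Longrightarrow> x = y"
  shows "rep_of N p = Some x \<longleftrightarrow> N p x"
proof -
  have "(THE x. N p x) = x" if "N p x" for x
    using that assms by (intro the_equality) auto
  then show ?thesis
    by (auto simp: rep_of_def)
qed


section \<open>Closed subsets of Cantor space\<close>

definition cylinder :: "bool list \<Rightarrow> cantor set" where
  "cylinder u = {x. \<forall>i<length u. x i = u ! i}"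

text \<open>
  Computability of \<open>n \<mapsto> w n\<close> means that one program outputs the letters of \<open>w n\<close> one after
  the other, followed by the end marker \<open>2\<close>.  Uniformity in the oracle makes the oracle
  irrelevant, i.e. this is ordinary computability.
\<close>

definition letter :: "bool list \<Rightarrow> nat \<Rightarrow> nat" where
  "letter u i = (if i < length u then of_bool (u ! i) else 2)"

definition computable_word_enumeration :: "(nat \<Rightarrow> bool list) \<Rightarrow> bool" where
  "computable_word_enumeration w \<longleftrightarrow>
     bij w \<and> (\<exists>e. \<forall>p n i. run p e [n, i] (letter (w n) i))"

definition names_pos :: "(nat \<Rightarrow> bool list) \<Rightarrow> baire \<Rightarrow> cantor set \<Rightarrow> bool" where
  "names_pos w p A \<longleftrightarrow>
     closed A \<and> {n. n + 1 \<in> range p} = {n. cylinder (w n) \<inter> A \<noteq> {}}"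

definition names_neg :: "(nat \<Rightarrow> bool list) \<Rightarrow> baire \<Rightarrow> cantor set \<Rightarrow> bool" where
  "names_neg w p A \<longleftrightarrow> A = UNIV - (\<Union>n\<in>{n. n + 1 \<in> range p}. cylinder (w n))"

definition baire_pair :: "baire \<Rightarrow> baire \<Rightarrow> baire" where
  "baire_pair p q n = (if even n then p (n div 2) else q (n div 2))"

definition names_full :: "(nat \<Rightarrow> bool list) \<Rightarrow> baire \<Rightarrow> cantor set \<Rightarrow> bool" where
  "names_full w r A \<longleftrightarrow> (\<exists>p q. r = baire_pair p q \<and> names_pos w p A \<and> names_neg w q A)"

definition rep_closed_pos :: "(nat \<Rightarrow> bool list) \<Rightarrow> (baire \<rightharpoonup> cantor set)" where
  "rep_closed_pos w = rep_of (names_pos w)"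

definition rep_closed :: "(nat \<Rightarrow> bool list) \<Rightarrow> (baire \<rightharpoonup> cantor set)" where
  "rep_closed w = rep_of (names_full w)"


section \<open>Cantor space and extended natural numbers as represented spaces\<close>

definition rep_cantor :: "baire \<rightharpoonup> cantor" where
  "rep_cantor = rep_of (\<lambda>p x. p = (\<lambda>i. of_bool (x i)))"

definition names_enat :: "baire \<Rightarrow> enat \<Rightarrow> bool" where
  "names_enat p m \<longleftrightarrow>
     (\<exists>n. (\<forall>i<n. p i = 0) \<and> p n = 1 \<and> m = enat n) \<or> ((\<forall>i. p i = 0) \<and> m = \<infinity>)"

definition rep_enat :: "baire \<rightharpoonup> enat" where
  "rep_enat = rep_of names_enat"


section \<open>VC dimension and sorting\<close>

definition shattered :: "cantor set \<Rightarrow> nat set \<Rightarrow> bool" where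
  "shattered C A \<longleftrightarrow> card ((\<lambda>B. {n. B n} \<inter> A) ` C) = 2 ^ card A"

definition VCdim :: "cantor set \<Rightarrow> enat" where
  "VCdim C = (if C = {} then 0 else (SUP A\<in>{A. finite A \<and> shattered C A}. enat (card A)))"

definition SORT :: "cantor \<Rightarrow> cantor" where
  "SORT p = (if infinite {i. \<not> p i} then (\<lambda>i. False) else (\<lambda>i. card {i. \<not> p i} \<le> i))"

definition VCdim_problem :: "(nat \<Rightarrow> bool list) \<Rightarrow> (cantor set, enat) problem" where
  "VCdim_problem w =
     \<lparr>in_rep = rep_closed w, out_rep = rep_enat, mv = (\<lambda>C. {VCdim C})\<rparr>"

definition VCdim_pos_problem :: "(nat \<Rightarrow> bool list) \<Rightarrow> (cantor set, enat) problem" where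
  "VCdim_pos_problem w =
     \<lparr>in_rep = rep_closed_pos w, out_rep = rep_enat, mv = (\<lambda>C. {VCdim C})\<rparr>"

definition SORT_problem :: "(cantor, cantor) problem" where
  "SORT_problem = \<lparr>in_rep = rep_cantor, out_rep = rep_cantor, mv = (\<lambda>p. {SORT p})\<rparr>"


section \<open>The naming relations are representations\<close>

lemma rep_cantor_eq_Some_iff: "rep_cantor p = Some x \<longleftrightarrow> p = (\<lambda>i. of_bool (x i))"
  unfolding rep_cantor_def
proof (rule rep_of_eq_Some_iff)
  fix p :: baire and x y :: cantor
  assume "p = (\<lambda>i. of_bool (x i))" "p = (\<lambda>i. of_bool (y i))"
  then have "(\<lambda>i. of_bool (x i) :: nat) = (\<lambda>i. of_bool (y i))"
    by simp
  then have "x i = y i" for i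
    using of_bool_eq_iff fun_cong by metis
  then show "x = y" by (rule ext)
qed

lemma names_enat_unique:
  assumes "names_enat p m" "names_enat p k" shows "m = k"
proof -
  have "n = n'" if "\<forall>i<n. p i = 0" "p n = 1" "\<forall>i<n'. p i = 0" "p n' = 1" for n n'
    using that by (metis linorder_neqE_nat zero_neq_one)
  then show ?thesis
    using assms unfolding names_enat_def by auto
qed

lemma rep_enat_eq_Some_iff: "rep_enat p = Some m \<longleftrightarrow> names_enat p m"
  unfolding rep_enat_def using names_enat_unique by (rule rep_of_eq_Some_iff)

lemma ran_rep_enat: "ran rep_enat = UNIV"
proof -
  have "\<exists>p. names_enat p m" for m
  proof (cases m)
    case (enat n)
    then have "names_enat (\<lambda>i. if i < n then 0 else 1) m"
      by (auto simp: names_enat_def)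
    then show ?thesis by blast
  next
    case infinity
    then have "names_enat (\<lambda>i. 0) m"
      by (auto simp: names_enat_def)
    then show ?thesis by blast
  qed
  then show ?thesis
    by (auto simp: ran_def rep_enat_eq_Some_iff)
qed

lemma open_cylinder: "open (cylinder u)"
proof -
  have "cylinder u = (\<Inter>i\<in>{..<length u}. (\<lambda>x. x i) -` {u ! i})"
    by (auto simp: cylinder_def)
  moreover have "open ((\<lambda>x::cantor. x i) -` {u ! i})" for i
    by (intro open_vimage) (auto simp: open_discrete)
  ultimately show ?thesis
    by (auto intro!: open_INT)
qed

lemma open_contains_cylinder:
  assumes "open U" "x \<in> U"
  obtains u where "x \<in> cylinder u" "cylinder u \<subseteq> U"
proof -
  obtain X where X: "x \<in> Pi\<^sub>E UNIV X" "finite {i. X i \<noteq> UNIV}" "Pi\<^sub>E UNIV X \<subseteq> U"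
    using product_topology_open_contains_basis[of "\<lambda>i. euclidean" UNIV U x] assms
    by (auto simp: open_fun_def)
  obtain k where k: "\<And>i. X i \<noteq> UNIV \<Longrightarrow> i < k"
    using X(2) finite_nat_set_iff_bounded by auto
  have "cylinder (map x [0..<k]) \<subseteq> U"
  proof
    fix y assume y: "y \<in> cylinder (map x [0..<k])"
    have "y i \<in> X i" for i
      using X(1) k[of i] y by (cases "i < k") (auto simp: cylinder_def PiE_iff)
    then show "y \<in> U" using X(3) by auto
  qed
  moreover have "x \<in> cylinder (map x [0..<k])"
    by (auto simp: cylinder_def)
  ultimately show ?thesis using that by blast
qed

lemma closed_eq_by_cylinders:
  assumes "closed A" "closed B" "\<And>u. cylinder u \<inter> A \<noteq> {} \<longleftrightarrow> cylinder u \<inter> B \<noteq> {}"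
  shows "A = B"
proof -
  have *: "A \<subseteq> B"
    if "closed B" and meets: "\<And>u. cylinder u \<inter> A \<noteq> {} \<Longrightarrow> cylinder u \<inter> B \<noteq> {}" for A B
  proof
    fix x assume "x \<in> A"
    show "x \<in> B"
    proof (rule ccontr)
      assume "x \<notin> B"
      obtain u where "x \<in> cylinder u" "cylinder u \<subseteq> - B"
        using open_contains_cylinder[OF open_Compl[OF \<open>closed B\<close>], of x] \<open>x \<notin> B\<close>
        unfolding Compl_iff by metis
      then show False using meets[of u] \<open>x \<in> A\<close> by auto
    qed
  qed
  show ?thesis using *[of A B] *[of B A] assms by auto
qed

lemma names_pos_unique:
  assumes "surj w" "names_pos w p A" "names_pos w p B" shows "A = B"
proof (rule closed_eq_by_cylinders)
  show "closed A" "closed B" using assms by (auto simp: names_pos_def)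
  show "cylinder u \<inter> A \<noteq> {} \<longleftrightarrow> cylinder u \<inter> B \<noteq> {}" for u
  proof -
    obtain n where "u = w n" using assms(1) by auto
    then show ?thesis using assms(2,3) unfolding names_pos_def by blast
  qed
qed

lemma rep_closed_pos_eq_Some_iff:
  "surj w \<Longrightarrow> rep_closed_pos w p = Some A \<longleftrightarrow> names_pos w p A"
  unfolding rep_closed_pos_def by (rule rep_of_eq_Some_iff) (rule names_pos_unique)

lemma rep_closed_eq_Some_iff: "rep_closed w r = Some A \<longleftrightarrow> names_full w r A"
  unfolding rep_closed_def
proof (rule rep_of_eq_Some_iff)
  have inj: "q = q'" if "baire_pair p q = baire_pair p' q'" for p q p' q'
  proof
    show "q n = q' n" for n
      using fun_cong[OF that, of "2 * n + 1"] by (simp add: baire_pair_def)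
  qed
  show "A = B" if A: "names_full w r A" and B: "names_full w r B" for r A B
  proof -
    obtain p q where 1: "r = baire_pair p q" "names_neg w q A"
      using A unfolding names_full_def by blast
    obtain p' q' where 2: "r = baire_pair p' q'" "names_neg w q' B"
      using B unfolding names_full_def by blast
    have "q = q'" using inj 1(1) 2(1) by blast
    then show ?thesis using 1(2) 2(2) by (simp add: names_neg_def)
  qed
qed

lemma exists_range_Suc: "\<exists>p::baire. {n. n + 1 \<in> range p} = S"
  by (rule exI[of _ "\<lambda>n. if n \<in> S then n + 1 else 0"]) auto

lemma exists_names_pos: "closed A \<Longrightarrow> \<exists>p. names_pos w p A"
  unfolding names_pos_def using exists_range_Suc by simp

lemma exists_names_neg:
  assumes "surj w" "closed A" shows "\<exists>p. names_neg w p A"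
proof -
  obtain p :: baire where p: "{n. n + 1 \<in> range p} = {n. cylinder (w n) \<subseteq> - A}"
    using exists_range_Suc by blast
  have "x \<in> (\<Union>n\<in>{n. cylinder (w n) \<subseteq> - A}. cylinder (w n))" if "x \<notin> A" for x
  proof -
    obtain u where "x \<in> cylinder u" "cylinder u \<subseteq> - A"
      using open_contains_cylinder[OF open_Compl[OF assms(2)], of x] \<open>x \<notin> A\<close>
      unfolding Compl_iff by metis
    moreover obtain n where "u = w n" using assms(1) by auto
    ultimately show ?thesis by auto
  qed
  then have "names_neg w p A"
    unfolding names_neg_def p by auto
  then show ?thesis by blast
qed

lemma ran_rep_closed_pos:
  assumes "surj w" shows "ran (rep_closed_pos w) = {A. closed A}"
proof -
  have "A \<in> ran (rep_closed_pos w) \<longleftrightarrow> (\<exists>p. names_pos w p A)" for A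
    by (simp add: ran_def rep_closed_pos_eq_Some_iff[OF assms])
  moreover have "(\<exists>p. names_pos w p A) \<longleftrightarrow> closed A" for A
    using exists_names_pos[of A w] by (auto simp only: names_pos_def)
  ultimately show ?thesis by blast
qed

lemma ran_rep_closed:
  assumes "surj w" shows "ran (rep_closed w) = {A. closed A}"
proof -
  have "A \<in> ran (rep_closed w) \<longleftrightarrow> (\<exists>p q. names_pos w p A \<and> names_neg w q A)" for A
    unfolding ran_def rep_closed_eq_Some_iff names_full_def by blast
  moreover have "(\<exists>p q. names_pos w p A \<and> names_neg w q A) \<longleftrightarrow> closed A" for A
    using exists_names_pos[of A w] exists_names_neg[OF assms, of A] names_pos_def[of w _ A]
    by metis
  ultimately show ?thesis by blast
qed

end

theory Submission
  imports Defs
begin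

text \<open>
  It suffices to close the cycle VCdim \<open>\<le>\<close> VCdim+ \<open>\<le>\<close> SORT \<open>\<le>\<close> VCdim. The first reduction drops
  the negative information. For the second, a positive name of \<open>C\<close> eventually confirms that a
  given finite set is shattered, since this means that finitely many cylinders meet \<open>C\<close>. So one can
  compute a binary sequence that outputs a zero each time a shattered set larger than the number
  of zeros written so far has been confirmed; it has exactly \<open>VCdim C\<close> zeros, and sorting it yields
  a name of that number. For the third, the class of all subsets of the zero set of \<open>q\<close> has as
  VC dimension the number of zeros of \<open>q\<close>, and whether a cylinder meets it is decidable in \<open>q\<close>.
\<close>

section \<open>Total recursive functions relative to an oracle\<close>

text \<open>Totality, for all oracles at once, keeps the closure rules below free of conditions on
  definedness, except for unbounded search.\<close>

definition oracle_rec :: "nat \<Rightarrow> (baire \<Rightarrow> nat list \<Rightarrow> nat) \<Rightarrow> bool" where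
  "oracle_rec k f \<longleftrightarrow> (\<exists>e. \<forall>p xs. length xs = k \<longrightarrow> run p e xs (f p xs))"

abbreviation oracle_dec :: "nat \<Rightarrow> (baire \<Rightarrow> nat list \<Rightarrow> bool) \<Rightarrow> bool" where
  "oracle_dec k P \<equiv> oracle_rec k (\<lambda>p xs. of_bool (P p xs))"

lemma computable_total:
  assumes "oracle_rec (Suc 0) (\<lambda>p xs. F p (hd xs))"
  shows "computable (\<lambda>p. Some (F p))"
proof -
  obtain e where "\<And>p xs. length xs = Suc 0 \<Longrightarrow> run p e xs (F p (hd xs))"
    using assms unfolding oracle_rec_def by blast
  from this[of "[_]"] show ?thesis
    unfolding computable_def by auto
qed

lemma run_Proj_all: "list_all2 (\<lambda>g y. run p g xs y) (map Proj [0..<length xs]) xs"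
  by (auto simp: list_all2_conv_all_nth intro: run_Proj)

lemma oracle_rec_compose:
  assumes "oracle_rec m f" "length gs = m" "\<And>g. g \<in> set gs \<Longrightarrow> oracle_rec k g"
  shows "oracle_rec k (\<lambda>p xs. f p (map (\<lambda>g. g p xs) gs))"
proof -
  obtain ef where ef: "\<And>p xs. length xs = m \<Longrightarrow> run p ef xs (f p xs)"
    using assms(1) unfolding oracle_rec_def by blast
  obtain E where E: "\<And>g p xs. g \<in> set gs \<Longrightarrow> length xs = k \<Longrightarrow> run p (E g) xs (g p xs)"
    using assms(3) unfolding oracle_rec_def by metis
  have "run p (Comp ef (map E gs)) xs (f p (map (\<lambda>g. g p xs) gs))" if "length xs = k" for p xs
    using that assms(2)
    by (intro run_Comp[where ys = "map (\<lambda>g. g p xs) gs"] ef)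
       (auto simp: list_all2_conv_all_nth E)
  then show ?thesis unfolding oracle_rec_def by blast
qed

lemma oracle_rec_compose1:
  assumes "oracle_rec (Suc 0) (\<lambda>p xs. f p (hd xs))" "oracle_rec k a"
  shows "oracle_rec k (\<lambda>p xs. f p (a p xs))"
  using oracle_rec_compose[OF assms(1), of "[a]" k] assms by simp

lemma oracle_rec_compose2:
  assumes "oracle_rec (Suc (Suc 0)) (\<lambda>p xs. f p (hd xs) (hd (tl xs)))"
    "oracle_rec k a" "oracle_rec k b"
  shows "oracle_rec k (\<lambda>p xs. f p (a p xs) (b p xs))"
  using oracle_rec_compose[OF assms(1), of "[a, b]" k] assms by auto

lemma oracle_rec_compose3:
  assumes "oracle_rec (Suc (Suc (Suc 0))) (\<lambda>p xs. f p (hd xs) (hd (tl xs)) (hd (tl (tl xs))))"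
    "oracle_rec k a" "oracle_rec k b" "oracle_rec k c"
  shows "oracle_rec k (\<lambda>p xs. f p (a p xs) (b p xs) (c p xs))"
  using oracle_rec_compose[OF assms(1), of "[a, b, c]" k] assms by auto

named_theorems oracle_rec_intros

text \<open>
  Argument lists serve as de Bruijn environments accessed by \<open>hd\<close> and \<open>tl\<close>, so that the rules for
  bound variables below are higher-order patterns and can be applied by \<open>intro\<close>.
\<close>

lemma oracle_rec_var [oracle_rec_intros]:
  "oracle_rec (Suc k) (\<lambda>p xs. hd xs)"
  "oracle_rec (Suc (Suc k)) (\<lambda>p xs. hd (tl xs))"
  "oracle_rec (Suc (Suc (Suc k))) (\<lambda>p xs. hd (tl (tl xs)))"
  "oracle_rec (Suc (Suc (Suc (Suc k)))) (\<lambda>p xs. hd (tl (tl (tl xs))))"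
  "oracle_rec (Suc (Suc (Suc (Suc (Suc k))))) (\<lambda>p xs. hd (tl (tl (tl (tl xs)))))"
  "oracle_rec (Suc (Suc (Suc (Suc (Suc (Suc k)))))) (\<lambda>p xs. hd (tl (tl (tl (tl (tl xs))))))"
  "oracle_rec (Suc (Suc (Suc (Suc (Suc (Suc (Suc k))))))) (\<lambda>p xs. hd (tl (tl (tl (tl (tl (tl xs)))))))"
proof -
  have drop: "(tl ^^ i) xs = drop i xs" for i and xs :: "nat list"
    by (induction i) (auto simp: drop_Suc tl_drop)
  have "oracle_rec k (\<lambda>p xs. hd ((tl ^^ i) xs))" if "i < k" for i k
    unfolding oracle_rec_def drop using that
    by (intro exI[of _ "Proj i"]) (auto simp: hd_drop_conv_nth intro: run_Proj)
  note var = this[where i = 0] this[where i = 1] this[where i = 2] this[where i = 3]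
    this[where i = 4] this[where i = 5] this[where i = 6]
  show "oracle_rec (Suc k) (\<lambda>p xs. hd xs)"
    using var(1)[of "(Suc k)"] by (simp add: numeral_eq_Suc)
  show "oracle_rec (Suc (Suc k)) (\<lambda>p xs. hd (tl xs))"
    using var(2)[of "(Suc (Suc k))"] by (simp add: numeral_eq_Suc)
  show "oracle_rec (Suc (Suc (Suc k))) (\<lambda>p xs. hd (tl (tl xs)))"
    using var(3)[of "(Suc (Suc (Suc k)))"] by (simp add: numeral_eq_Suc)
  show "oracle_rec (Suc (Suc (Suc (Suc k)))) (\<lambda>p xs. hd (tl (tl (tl xs))))"
    using var(4)[of "(Suc (Suc (Suc (Suc k))))"] by (simp add: numeral_eq_Suc)
  show "oracle_rec (Suc (Suc (Suc (Suc (Suc k))))) (\<lambda>p xs. hd (tl (tl (tl (tl xs)))))"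
    using var(5)[of "(Suc (Suc (Suc (Suc (Suc k)))))"] by (simp add: numeral_eq_Suc)
  show "oracle_rec (Suc (Suc (Suc (Suc (Suc (Suc k)))))) (\<lambda>p xs. hd (tl (tl (tl (tl (tl xs))))))"
    using var(6)[of "(Suc (Suc (Suc (Suc (Suc (Suc k))))))"] by (simp add: numeral_eq_Suc)
  show "oracle_rec (Suc (Suc (Suc (Suc (Suc (Suc (Suc k))))))) (\<lambda>p xs. hd (tl (tl (tl (tl (tl (tl xs)))))))"
    using var(7)[of "(Suc (Suc (Suc (Suc (Suc (Suc (Suc k)))))))"] by (simp add: numeral_eq_Suc)
qed

lemma oracle_rec_Suc [oracle_rec_intros]:
  assumes "oracle_rec k a" shows "oracle_rec k (\<lambda>p xs. Suc (a p xs))"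
proof (rule oracle_rec_compose1[where f = "\<lambda>p. Suc", OF _ assms])
  show "oracle_rec (Suc 0) (\<lambda>p xs. Suc (hd xs))"
    unfolding oracle_rec_def by (rule exI[of _ Succ]) (auto simp: length_Suc_conv intro: run_Succ)
qed

lemma oracle_rec_oracle [oracle_rec_intros]:
  assumes "oracle_rec k a" shows "oracle_rec k (\<lambda>p xs. p (a p xs))"
proof (rule oracle_rec_compose1[where f = "\<lambda>p. p", OF _ assms])
  show "oracle_rec (Suc 0) (\<lambda>p xs. p (hd xs))"
    unfolding oracle_rec_def
    by (rule exI[of _ Oracle]) (auto simp: length_Suc_conv intro: run_Oracle)
qed

lemma oracle_rec_const [oracle_rec_intros]: "oracle_rec k (\<lambda>p xs. c)"
proof (induction c)
  case 0
  show ?case unfolding oracle_rec_def using run_Zero by blast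
qed (rule oracle_rec_Suc)

text \<open>\<open>PrimRec\<close> puts the recursive value and then the index in front of the
  arguments, so every recursion deepens the environment by two entries.\<close>

lemma oracle_rec_rec_nat [oracle_rec_intros]:
  assumes "oracle_rec k n" "oracle_rec k f"
    and "oracle_rec (Suc (Suc k)) (\<lambda>p xs. g p (tl (tl xs)) (hd (tl xs)) (hd xs))"
  shows "oracle_rec k (\<lambda>p xs. rec_nat (f p xs) (g p xs) (n p xs))"
proof -
  obtain en where en: "\<And>p xs. length xs = k \<Longrightarrow> run p en xs (n p xs)"
    using assms(1) unfolding oracle_rec_def by blast
  obtain ef where ef: "\<And>p xs. length xs = k \<Longrightarrow> run p ef xs (f p xs)"
    using assms(2) unfolding oracle_rec_def by blast
  obtain eg where eg: "\<And>p xs. length xs = Suc (Suc k) \<Longrightarrow>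
      run p eg xs (g p (tl (tl xs)) (hd (tl xs)) (hd xs))"
    using assms(3) unfolding oracle_rec_def by blast
  have iter: "run p (PrimRec ef eg) (m # xs) (rec_nat (f p xs) (g p xs) m)" if "length xs = k"
    for p xs m
  proof (induction m)
    case 0
    show ?case using ef[OF that] by (simp add: run_PrimRec_0)
  next
    case (Suc m)
    show ?case
      using run_PrimRec_Suc[OF Suc, of "g p xs m (rec_nat (f p xs) (g p xs) m)"]
        eg[of "rec_nat (f p xs) (g p xs) m # m # xs" p] that by simp
  qed
  have "run p (Comp (PrimRec ef eg) (en # map Proj [0..<k])) xs (rec_nat (f p xs) (g p xs) (n p xs))"
    if "length xs = k" for p xs
    using that en[OF that] run_Proj_all[of p xs]
    by (intro run_Comp[where ys = "n p xs # xs"] iter) auto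
  then show ?thesis unfolding oracle_rec_def by blast
qed

text \<open>\<open>Mu\<close> searches for a zero, hence the negation in the first premise; the
  second one makes the search halt.\<close>

lemma oracle_rec_Least:
  assumes "oracle_rec (Suc k) (\<lambda>p xs. of_bool (\<not> P p (tl xs) (hd xs)))"
    and "\<And>p xs. \<exists>i. P p xs i"
  shows "oracle_rec k (\<lambda>p xs. LEAST i. P p xs i)"
proof -
  obtain e where e: "\<And>p xs. length xs = Suc k \<Longrightarrow> run p e xs (of_bool (\<not> P p (tl xs) (hd xs)))"
    using assms(1) unfolding oracle_rec_def by blast
  have "run p (Mu e) xs (LEAST i. P p xs i)" if "length xs = k" for p xs
  proof (rule run_Mu)
    show "run p e ((LEAST i. P p xs i) # xs) 0"
      using e[of "(LEAST i. P p xs i) # xs" p] that LeastI_ex[OF assms(2), of p xs] by simp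
    show "\<forall>m<LEAST i. P p xs i. \<exists>k. run p e (m # xs) (Suc k)"
    proof (intro allI impI)
      fix m assume "m < (LEAST i. P p xs i)"
      then have "\<not> P p xs m" by (rule not_less_Least)
      then show "\<exists>k. run p e (m # xs) (Suc k)"
        using e[of "m # xs" p] that by (intro exI[of _ 0]) simp
    qed
  qed
  then show ?thesis unfolding oracle_rec_def by blast
qed

section \<open>Arithmetic and definition by cases\<close>

lemma oracle_rec_add [oracle_rec_intros]:
  assumes "oracle_rec k a" "oracle_rec k b" shows "oracle_rec k (\<lambda>p xs. a p xs + b p xs)"
proof -
  have "m + n = rec_nat m (\<lambda>_. Suc) n" for m n :: nat by (induction n) auto
  then show ?thesis by (simp only:) (intro oracle_rec_intros assms)
qed

lemma oracle_rec_diff [oracle_rec_intros]: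
  assumes "oracle_rec k a" "oracle_rec k b" shows "oracle_rec k (\<lambda>p xs. a p xs - b p xs)"
proof -
  \<comment> \<open>Returning the previous index is the predecessor; iterating it gives truncated
    subtraction.\<close>
  have pred: "rec_nat 0 (\<lambda>i _. i) m = m - 1" for m :: nat by (cases m) auto
  have "m - n = rec_nat m (\<lambda>_ r. rec_nat 0 (\<lambda>i _. i) r) n" for m n :: nat
    unfolding pred by (induction n) auto
  then show ?thesis by (simp only:) (intro oracle_rec_intros assms)
qed

lemma oracle_rec_power2 [oracle_rec_intros]:
  assumes "oracle_rec k a" shows "oracle_rec k (\<lambda>p xs. 2 ^ a p xs)"
proof -
  have "(2::nat) ^ n = rec_nat 1 (\<lambda>_ r. r + r) n" for n by (induction n) auto
  then show ?thesis by (simp only:) (intro oracle_rec_intros assms)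
qed

lemma oracle_rec_div2 [oracle_rec_intros]:
  assumes "oracle_rec k a" shows "oracle_rec k (\<lambda>p xs. a p xs div 2)"
proof -
  have "n div 2 = rec_nat 0 (\<lambda>i r. i - r) n" for n :: nat
  proof (induction n)
    case (Suc n)
    \<comment> \<open>The halves \<open>n div 2\<close> and \<open>Suc n div 2\<close> add up to
      \<open>n\<close>.\<close>
    have "Suc n div 2 = n - n div 2" by presburger
    then show ?case using Suc by simp
  qed simp
  then show ?thesis by (simp only:) (intro oracle_rec_intros assms)
qed

lemma oracle_rec_if [oracle_rec_intros]:
  assumes "oracle_dec k P" "oracle_rec k a" "oracle_rec k b"
  shows "oracle_rec k (\<lambda>p xs. if P p xs then a p xs else b p xs)"
proof -
  \<comment> \<open>Recursion on the truth value: no step leaves \<open>b\<close>, one step replaces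
    it by \<open>a\<close>; \<open>hd [m]\<close> is just \<open>m\<close>.\<close>
  have "oracle_rec k (\<lambda>p xs. rec_nat (b p xs) (\<lambda>_ _. hd [a p xs]) (of_bool (P p xs)))"
  proof (rule oracle_rec_rec_nat[OF assms(1,3)])
    obtain e where e: "\<And>p xs. length xs = k \<Longrightarrow> run p e xs (a p xs)"
      using assms(2) unfolding oracle_rec_def by blast
    have "run p (Comp e (map (\<lambda>i. Proj (i + 2)) [0..<k])) (r # m # xs) (a p xs)"
      if "length xs = k" for p r m xs
      using that
      by (intro run_Comp[where ys = xs] e)
         (auto simp: list_all2_conv_all_nth intro!: run_Proj[of "_ + 2" "r # m # xs" p, simplified])
    then have "\<forall>p xs. length xs = Suc (Suc k) \<longrightarrow>
        run p (Comp e (map (\<lambda>i. Proj (i + 2)) [0..<k])) xs (hd [a p (tl (tl xs))])"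
      by (auto simp: length_Suc_conv)
    then show "oracle_rec (Suc (Suc k)) (\<lambda>p xs. hd [a p (tl (tl xs))])"
      unfolding oracle_rec_def by blast
  qed
  moreover have "rec_nat n (\<lambda>_ _. hd [m]) (of_bool b) = (if b then m else n)" for m n :: nat and b
    by simp
  ultimately show ?thesis by (simp only:)
qed

section \<open>Decidable predicates, bounded counting and bounded quantifiers\<close>

lemma oracle_dec_eq [oracle_rec_intros]:
  assumes "oracle_rec k a" "oracle_rec k b" shows "oracle_dec k (\<lambda>p xs. a p xs = b p xs)"
proof -
  have "of_bool (m = n) = Suc 0 - ((m - n) + (n - m))" for m n :: nat by (simp add: of_bool_def)
  then show ?thesis by (simp only:) (intro oracle_rec_intros assms)
qed

lemma oracle_dec_not [oracle_rec_intros]: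
  assumes "oracle_dec k P" shows "oracle_dec k (\<lambda>p xs. \<not> P p xs)"
proof -
  have "of_bool (\<not> b) = Suc 0 - of_bool b" for b by simp
  then show ?thesis by (simp only:) (intro oracle_rec_intros assms)
qed

lemma oracle_dec_conj [oracle_rec_intros]:
  assumes "oracle_dec k P" "oracle_dec k Q" shows "oracle_dec k (\<lambda>p xs. P p xs \<and> Q p xs)"
proof -
  have "of_bool (b \<and> c) = (if b then of_bool c else 0 :: nat)" for b c by simp
  then show ?thesis by (simp only:) (intro oracle_rec_intros assms)
qed

lemma oracle_dec_imp [oracle_rec_intros]:
  assumes "oracle_dec k P" "oracle_dec k Q" shows "oracle_dec k (\<lambda>p xs. P p xs \<longrightarrow> Q p xs)"
proof -
  have "of_bool (b \<longrightarrow> c) = (if b then of_bool c else 1 :: nat)" for b c by simp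
  then show ?thesis by (simp only:) (intro oracle_rec_intros assms)
qed

lemma oracle_dec_iff [oracle_rec_intros]:
  assumes "oracle_dec k P" "oracle_dec k Q" shows "oracle_dec k (\<lambda>p xs. P p xs \<longleftrightarrow> Q p xs)"
proof -
  have "of_bool (b \<longleftrightarrow> c) = (of_bool (of_bool b = (of_bool c :: nat)) :: nat)" for b c by simp
  then show ?thesis by (simp only:) (intro oracle_rec_intros assms)
qed

lemma oracle_dec_even [oracle_rec_intros]:
  assumes "oracle_rec k a" shows "oracle_dec k (\<lambda>p xs. even (a p xs))"
proof -
  have "even n \<longleftrightarrow> n div 2 + n div 2 = n" for n :: nat by presburger
  then show ?thesis by (simp only:) (intro oracle_rec_intros assms)
qed

text \<open>Bounded counting is a recursion whose value is the running count; the predicate finds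
  its index behind that count, as the second entry. The bounded quantifiers below test such counts
  for zero.\<close>

lemma oracle_rec_card [oracle_rec_intros]:
  assumes "oracle_rec k n" "oracle_dec (Suc (Suc k)) (\<lambda>p xs. P p (tl (tl xs)) (hd (tl xs)))"
  shows "oracle_rec k (\<lambda>p xs. card {i. i < n p xs \<and> P p xs i})"
proof -
  have card: "card {i. i < n \<and> Q i} = rec_nat 0 (\<lambda>i r. r + of_bool (Q i)) n" for n and Q :: "nat \<Rightarrow> bool"
  proof (induction n)
    case (Suc n)
    have "{i. i < Suc n \<and> Q i} = {i. i < n \<and> Q i} \<union> (if Q n then {n} else {})"
      by (auto simp: less_Suc_eq)
    then show ?case using Suc by simp
  qed simp
  show ?thesis unfolding card by (intro oracle_rec_intros assms)
qed

lemma oracle_dec_ex [oracle_rec_intros]: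
  assumes "oracle_rec k n" "oracle_dec (Suc (Suc k)) (\<lambda>p xs. P p (tl (tl xs)) (hd (tl xs)))"
  shows "oracle_dec k (\<lambda>p xs. \<exists>i<n p xs. P p xs i)"
proof -
  have "(\<exists>i<m. Q i) \<longleftrightarrow> \<not> card {i. i < m \<and> Q i} = 0" for m and Q :: "nat \<Rightarrow> bool" by auto
  then show ?thesis by (simp only:) (intro oracle_rec_intros assms)
qed

lemma oracle_dec_all [oracle_rec_intros]:
  assumes "oracle_rec k n" "oracle_dec (Suc (Suc k)) (\<lambda>p xs. P p (tl (tl xs)) (hd (tl xs)))"
  shows "oracle_dec k (\<lambda>p xs. \<forall>i<n p xs. P p xs i)"
proof -
  have "(\<forall>i<m. Q i) \<longleftrightarrow> card {i. i < m \<and> \<not> Q i} = 0" for m and Q :: "nat \<Rightarrow> bool" by auto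
  then show ?thesis by (simp only:) (intro oracle_rec_intros assms)
qed

section \<open>Strong Weihrauch reducibility is transitive\<close>

text \<open>Composition of functionals at the level of programs: each query is answered by running a
  program for the oracle.\<close>

primrec subst_oracle :: "prog \<Rightarrow> prog \<Rightarrow> prog" where
  "subst_oracle d Zero = Zero"
| "subst_oracle d Succ = Succ"
| "subst_oracle d (Proj i) = Proj i"
| "subst_oracle d Oracle = d"
| "subst_oracle d (Comp f gs) = Comp (subst_oracle d f) (map (subst_oracle d) gs)"
| "subst_oracle d (PrimRec f g) = PrimRec (subst_oracle d f) (subst_oracle d g)"
| "subst_oracle d (Mu f) = Mu (subst_oracle d f)"

lemma run_subst_oracle:
  assumes "run q e xs y" "\<And>n. run p d [n] (q n)"
  shows "run p (subst_oracle d e) xs y"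
  using assms(1)
proof (induction rule: run.induct)
  case (run_Comp xs gs ys f z)
  then show ?case
    by (auto intro!: run.run_Comp[where ys = ys] simp: list_all2_conv_all_nth)
next
  case (run_Mu f n xs)
  then show ?case
    by (auto intro!: run.run_Mu)
qed (auto intro: run.intros assms(2))

lemma computable_map_comp:
  assumes "computable F" "computable G" shows "computable (F \<circ>\<^sub>m G)"
proof -
  obtain e d where e: "\<And>p q n. F p = Some q \<Longrightarrow> run p e [n] (q n)"
    and d: "\<And>p q n. G p = Some q \<Longrightarrow> run p d [n] (q n)"
    using assms unfolding computable_def by blast
  have "run p (subst_oracle d e) [n] (q n)" if pq: "(F \<circ>\<^sub>m G) p = Some q" for p q n
  proof -
    obtain r where "G p = Some r" "F r = Some q"
      using pq by (auto simp: map_comp_Some_iff)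
    then show ?thesis using run_subst_oracle e d by metis
  qed
  then show ?thesis unfolding computable_def by blast
qed

lemma sW_le_trans:
  assumes "f \<le>\<^sub>s\<^sub>W g" "g \<le>\<^sub>s\<^sub>W h" shows "f \<le>\<^sub>s\<^sub>W h"
proof -
  obtain H K where 1: "computable H" "computable K"
    "\<And>G. realizes G g \<Longrightarrow> realizes (H \<circ>\<^sub>m G \<circ>\<^sub>m K) f"
    using assms(1) unfolding sW_le_def by blast
  obtain H' K' where 2: "computable H'" "computable K'"
    "\<And>G. realizes G h \<Longrightarrow> realizes (H' \<circ>\<^sub>m G \<circ>\<^sub>m K') g"
    using assms(2) unfolding sW_le_def by blast
  have assoc: "H \<circ>\<^sub>m H' \<circ>\<^sub>m G \<circ>\<^sub>m (K' \<circ>\<^sub>m K) = H \<circ>\<^sub>m (H' \<circ>\<^sub>m G \<circ>\<^sub>m K') \<circ>\<^sub>m K" for G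
    by (rule ext) (simp add: map_comp_def split: option.split)
  have "realizes (H \<circ>\<^sub>m H' \<circ>\<^sub>m G \<circ>\<^sub>m (K' \<circ>\<^sub>m K)) f" if "realizes G h" for G
    unfolding assoc using 1(3) 2(3) that by blast
  then show ?thesis
    unfolding sW_le_def using computable_map_comp 1(1,2) 2(1,2) by blast
qed

text \<open>All three reductions have total \<open>H\<close> and \<open>K\<close>, so it is enough
  to follow names. \<open>H\<close> has to succeed on every name of a solution, since it does not
  see the original input.\<close>

lemma sW_le_totalI:
  assumes "oracle_rec (Suc 0) (\<lambda>p xs. H p (hd xs))" "oracle_rec (Suc 0) (\<lambda>p xs. K p (hd xs))"
    and "\<And>p x. in_rep f p = Some x \<Longrightarrow> mv f x \<noteq> {} \<Longrightarrow>
      \<exists>u. in_rep g (K p) = Some u \<and> mv g u \<noteq> {} \<and>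
        (\<forall>q v. out_rep g q = Some v \<and> v \<in> mv g u \<longrightarrow> (\<exists>y\<in>mv f x. out_rep f (H q) = Some y))"
  shows "f \<le>\<^sub>s\<^sub>W g"
proof -
  have "realizes ((\<lambda>q. Some (H q)) \<circ>\<^sub>m G \<circ>\<^sub>m (\<lambda>p. Some (K p))) f" if G: "realizes G g" for G
    unfolding realizes_def
  proof (intro allI impI, elim conjE)
    fix p x assume "in_rep f p = Some x" "mv f x \<noteq> {}"
    from assms(3)[OF this] obtain u where u: "in_rep g (K p) = Some u" "mv g u \<noteq> {}"
      "\<And>q v. out_rep g q = Some v \<Longrightarrow> v \<in> mv g u \<Longrightarrow> \<exists>y\<in>mv f x. out_rep f (H q) = Some y"
      by blast
    obtain q v where "G (K p) = Some q" "out_rep g q = Some v" "v \<in> mv g u"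
      using G u(1,2) unfolding realizes_def by blast
    with u(3)[OF this(2,3)]
    show "\<exists>q y. ((\<lambda>q. Some (H q)) \<circ>\<^sub>m G \<circ>\<^sub>m (\<lambda>p. Some (K p))) p = Some q \<and>
        out_rep f q = Some y \<and> y \<in> mv f x"
      by (auto simp: map_comp_def)
  qed
  then show ?thesis
    unfolding sW_le_def using computable_total[OF assms(1)] computable_total[OF assms(2)] by blast
qed

section \<open>Dropping the negative information\<close>

lemma VCdim_le_VCdim_pos:
  assumes "surj w" shows "VCdim_problem w \<le>\<^sub>s\<^sub>W VCdim_pos_problem w"
proof (rule sW_le_totalI[where H = "\<lambda>p n. p n" and K = "\<lambda>p n. p (n + n)"])
  fix r C assume "in_rep (VCdim_problem w) r = Some C"
  then obtain p q where r: "r = baire_pair p q" "names_pos w p C"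
    by (auto simp: VCdim_problem_def rep_closed_eq_Some_iff names_full_def)
  have "(\<lambda>n. r (n + n)) = p"
    by (rule ext) (simp add: r baire_pair_def flip: mult_2)
  then show "\<exists>u. in_rep (VCdim_pos_problem w) (\<lambda>n. r (n + n)) = Some u \<and>
      mv (VCdim_pos_problem w) u \<noteq> {} \<and>
      (\<forall>q v. out_rep (VCdim_pos_problem w) q = Some v \<and> v \<in> mv (VCdim_pos_problem w) u \<longrightarrow>
        (\<exists>y\<in>mv (VCdim_problem w) C. out_rep (VCdim_problem w) q = Some y))"
    using r(2) assms
    by (auto simp: VCdim_pos_problem_def VCdim_problem_def rep_closed_pos_eq_Some_iff)
qed (intro oracle_rec_intros)+

section \<open>Sizes of sets and VC dimension as extended natural numbers\<close>

definition ecard :: "'a set \<Rightarrow> enat" where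
  "ecard S = (if finite S then enat (card S) else \<infinity>)"

lemma enat_le_ecard_iff: "enat k \<le> ecard S \<longleftrightarrow> (\<exists>T\<subseteq>S. finite T \<and> card T = k)"
proof (cases "finite S")
  case True
  then show ?thesis
    by (auto simp: ecard_def intro: card_mono) (metis obtain_subset_with_card_n)
next
  case False
  then show ?thesis
    using infinite_arbitrarily_large[OF False, of k] by (auto simp: ecard_def)
qed

text \<open>Zero is left out for the sake of \<open>enat_le_VCdim_iff\<close>: the empty class has
  dimension 0 but does not shatter even the empty set.\<close>

lemma enat_eqI_positive:
  assumes "\<And>k. 0 < k \<Longrightarrow> enat k \<le> a \<longleftrightarrow> enat k \<le> b" shows "a = b"
proof -
  have le: "x \<le> y" if "\<And>k. 0 < k \<Longrightarrow> enat k \<le> x \<Longrightarrow> enat k \<le> y" for x y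
  proof (rule ccontr)
    assume "\<not> x \<le> y"
    then obtain n where n: "y = enat n" "enat n < x" by (cases y) auto
    then have "enat (Suc n) \<le> x" by (simp add: Suc_ile_eq)
    with that[of "Suc n"] n show False by simp
  qed
  show ?thesis using le[of a b] le[of b a] assms by (auto intro: antisym)
qed

text \<open>All traces lie in \<open>Pow A\<close>, which has \<open>2 ^ card A\<close> elements, so
  the count is full exactly when every subset is a trace.\<close>

lemma shattered_iff:
  assumes "finite A"
  shows "shattered C A \<longleftrightarrow> (\<forall>B\<subseteq>A. \<exists>x\<in>C. {n. x n} \<inter> A = B)"
proof -
  have sub: "(\<lambda>x. {n. x n} \<inter> A) ` C \<subseteq> Pow A" by auto
  have "shattered C A \<longleftrightarrow> (\<lambda>x. {n. x n} \<inter> A) ` C = Pow A"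
    unfolding shattered_def card_Pow[OF assms, symmetric]
    using card_subset_eq[OF _ sub] assms by auto
  also have "\<dots> \<longleftrightarrow> Pow A \<subseteq> (\<lambda>x. {n. x n} \<inter> A) ` C"
    by (simp only: set_eq_subset sub simp_thms)
  also have "\<dots> \<longleftrightarrow> (\<forall>B\<subseteq>A. \<exists>x\<in>C. {n. x n} \<inter> A = B)"
    by (simp add: subset_iff[of "Pow A"] image_iff eq_commute)
  finally show ?thesis .
qed

lemma shattered_subset:
  assumes "finite A" "shattered C A" "B \<subseteq> A" shows "shattered C B"
proof -
  have "\<exists>x\<in>C. {n. x n} \<inter> B = D" if D: "D \<subseteq> B" for D
  proof -
    obtain x where "x \<in> C" "{n. x n} \<inter> A = D"
      using assms(2) D assms(3) unfolding shattered_iff[OF assms(1)] by (meson order_trans)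
    then show ?thesis using assms(3) D by (intro bexI[of _ x]) auto
  qed
  then show ?thesis using shattered_iff finite_subset[OF assms(3,1)] by blast
qed

lemma enat_le_VCdim_iff:
  assumes "0 < k"
  shows "enat k \<le> VCdim C \<longleftrightarrow> (\<exists>A. finite A \<and> card A = k \<and> shattered C A)"
proof (cases "C = {}")
  case True
  then show ?thesis using assms by (auto simp: VCdim_def shattered_def zero_enat_def)
next
  case False
  show ?thesis
  proof
    assume k: "enat k \<le> VCdim C"
    \<comment> \<open>Otherwise the supremum would be at most \<open>k - 1\<close>. The set found is
      then thinned to exactly \<open>k\<close> elements.\<close>
    have "\<exists>A. finite A \<and> shattered C A \<and> k \<le> card A"
    proof (rule ccontr)
      assume "\<not> ?thesis"
      then have "VCdim C \<le> enat (k - 1)"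
        using False by (auto simp: VCdim_def not_le intro!: SUP_least)
      with k have "enat k \<le> enat (k - 1)" by (rule order_trans)
      then show False using assms by simp
    qed
    then show "\<exists>A. finite A \<and> card A = k \<and> shattered C A"
      by (metis obtain_subset_with_card_n shattered_subset)
  next
    assume "\<exists>A. finite A \<and> card A = k \<and> shattered C A"
    then show "enat k \<le> VCdim C"
      using False by (auto simp: VCdim_def intro!: SUP_upper)
  qed
qed

text \<open>Both cases of \<open>SORT\<close> merge, because \<infinity> lies below no finite
  number.\<close>

lemma SORT_iff: "SORT x i \<longleftrightarrow> ecard {i. \<not> x i} \<le> enat i"
  by (simp add: SORT_def ecard_def)

text \<open>Because of this, the reduction to \<open>SORT\<close> needs no postprocessing.\<close>

lemma names_enat_SORT: "names_enat (\<lambda>i. of_bool (SORT x i)) (ecard {i. \<not> x i})"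
  by (cases "ecard {i. \<not> x i}") (auto simp: names_enat_def SORT_iff)

text \<open>A name is arbitrary behind its first 1, so all entries up to \<open>n\<close> are
  inspected and not entry \<open>n\<close> alone.\<close>

lemma names_enat_le_iff:
  assumes "names_enat q m" shows "m \<le> enat n \<longleftrightarrow> (\<exists>i<Suc n. q i \<noteq> 0)"
  using assms unfolding names_enat_def
proof (elim disjE exE conjE)
  fix l assume l: "\<forall>i<l. q i = 0" "q l = 1" "m = enat l"
  show ?thesis
  proof (cases "l \<le> n")
    case True
    then have "l < Suc n \<and> q l \<noteq> 0" using l(2) by simp
    then have "\<exists>i<Suc n. q i \<noteq> 0" by blast
    then show ?thesis using True l(3) by simp
  qed (use l in auto)
qed auto

section \<open>Sorting reduces to VC dimension\<close>

lemma oracle_rec_letter: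
  assumes "computable_word_enumeration w" "oracle_rec k a" "oracle_rec k b"
  shows "oracle_rec k (\<lambda>p xs. letter (w (a p xs)) (b p xs))"
proof (rule oracle_rec_compose2[where f = "\<lambda>p n. letter (w n)", OF _ assms(2,3)])
  obtain e where "\<And>p n i. run p e [n, i] (letter (w n) i)"
    using assms(1) unfolding computable_word_enumeration_def by blast
  then show "oracle_rec (Suc (Suc 0)) (\<lambda>p xs. letter (w (hd xs)) (hd (tl xs)))"
    unfolding oracle_rec_def by (intro exI[of _ e]) (auto simp: length_Suc_conv)
qed

text \<open>The length is the position of the first end marker, found by a search that halts because
  words are finite.\<close>

lemma oracle_rec_length:
  assumes "computable_word_enumeration w" "oracle_rec k a"
  shows "oracle_rec k (\<lambda>p xs. length (w (a p xs)))"
proof (rule oracle_rec_compose1[where f = "\<lambda>p n. length (w n)", OF _ assms(2)])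
  have *: "letter u (length u) = 2" for u by (simp add: letter_def)
  have "(LEAST i. letter u i = 2) = length u" for u
    by (rule Least_equality) (auto simp: letter_def of_bool_def split: if_splits)
  moreover have "oracle_rec (Suc 0) (\<lambda>p xs. LEAST i. letter (w (hd xs)) i = 2)"
    using * by (intro oracle_rec_Least oracle_rec_intros oracle_rec_letter assms(1)) blast
  ultimately show "oracle_rec (Suc 0) (\<lambda>p xs. length (w (hd xs)))" by simp
qed

definition subsets_class :: "nat set \<Rightarrow> cantor set" where
  "subsets_class Z = {x. \<forall>i. x i \<longrightarrow> i \<in> Z}"

text \<open>The finite shattered sets are the finite subsets of \<open>Z\<close>: the trace
  \<open>A\<close> itself forces \<open>A \<subseteq> Z\<close>, and conversely every
  \<open>B \<subseteq> A\<close> is a member of the class.\<close>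

lemma VCdim_subsets_class: "VCdim (subsets_class Z) = ecard Z"
proof (rule enat_eqI_positive)
  fix k :: nat assume k: "0 < k"
  have "shattered (subsets_class Z) A \<longleftrightarrow> A \<subseteq> Z" if "finite A" for A
    unfolding shattered_iff[OF that]
  proof safe
    fix i assume "\<forall>B\<subseteq>A. \<exists>x\<in>subsets_class Z. {n. x n} \<inter> A = B" "i \<in> A"
    then obtain x where "x \<in> subsets_class Z" "{n. x n} \<inter> A = A" by blast
    then show "i \<in> Z" using \<open>i \<in> A\<close> by (auto simp: subsets_class_def)
  next
    fix B assume "A \<subseteq> Z" "B \<subseteq> A"
    then show "\<exists>x\<in>subsets_class Z. {n. x n} \<inter> A = B"
      by (intro bexI[of _ "\<lambda>i. i \<in> B"]) (auto simp: subsets_class_def)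
  qed
  then show "enat k \<le> VCdim (subsets_class Z) \<longleftrightarrow> enat k \<le> ecard Z"
    unfolding enat_le_VCdim_iff[OF k] enat_le_ecard_iff by blast
qed

lemma closed_subsets_class: "closed (subsets_class Z)"
proof -
  have "subsets_class Z = (\<Inter>i. (\<lambda>x. x i) -` {b. b \<longrightarrow> i \<in> Z})"
    by (auto simp: subsets_class_def)
  moreover have "closed ((\<lambda>x::cantor. x i) -` B)" for i B
    unfolding closed_def vimage_Compl[symmetric] by (intro open_vimage) (auto simp: open_discrete)
  ultimately show ?thesis by (simp only:) (intro closed_INT ballI)
qed

text \<open>Extending a word by zeros gives the least set in its cylinder, so the ones among its
  finitely many letters decide.\<close>

lemma cylinder_meets_subsets_class_iff:
  "cylinder u \<inter> subsets_class Z \<noteq> {} \<longleftrightarrow> (\<forall>i<length u. letter u i = 1 \<longrightarrow> i \<in> Z)"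
proof
  assume "\<forall>i<length u. letter u i = 1 \<longrightarrow> i \<in> Z"
  then have "(\<lambda>i. i < length u \<and> u ! i) \<in> cylinder u \<inter> subsets_class Z"
    by (auto simp: cylinder_def subsets_class_def letter_def)
  then show "cylinder u \<inter> subsets_class Z \<noteq> {}" by blast
qed (auto simp: cylinder_def subsets_class_def letter_def)

lemma SORT_le_VCdim:
  assumes w: "computable_word_enumeration w" shows "SORT_problem \<le>\<^sub>s\<^sub>W VCdim_problem w"
proof -
  have surj: "surj w"
    using w by (auto simp: computable_word_enumeration_def bij_def)
  define ok where "ok q n \<longleftrightarrow> (\<forall>i<length (w n). letter (w n) i = 1 \<longrightarrow> q i = 0)" for q :: baire and n
  \<comment> \<open>A nonzero entry up to \<open>n\<close> shows that the dimension is at most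
    \<open>n\<close>, which is when \<open>SORT\<close> writes a one.\<close>
  define H :: "baire \<Rightarrow> baire" where "H q n = of_bool (\<exists>i<Suc n. \<not> q i = 0)" for q n
  \<comment> \<open>Even positions list the cylinders meeting the class and odd ones those missing
    it; indices are shifted by one and 0 is a blank.\<close>
  define K :: "baire \<Rightarrow> baire" where
    "K q m = (if even m \<longleftrightarrow> ok q (m div 2) then Suc (m div 2) else 0)" for q m
  show ?thesis
  proof (rule sW_le_totalI)
    show "oracle_rec (Suc 0) (\<lambda>p xs. H p (hd xs))"
      unfolding H_def by (intro oracle_rec_intros)
    show "oracle_rec (Suc 0) (\<lambda>p xs. K p (hd xs))"
      unfolding K_def ok_def
      by (intro oracle_rec_intros oracle_rec_length oracle_rec_letter w)
  next
    fix q x assume "in_rep SORT_problem q = Some x"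
    then have q: "q = (\<lambda>i. of_bool (x i))"
      by (simp add: SORT_problem_def rep_cantor_eq_Some_iff)
    define C where "C = subsets_class {i. \<not> x i}"
    have ok: "ok q n \<longleftrightarrow> cylinder (w n) \<inter> C \<noteq> {}" for n
      unfolding C_def cylinder_meets_subsets_class_iff ok_def q by auto
    define a b :: baire where "a n = (if ok q n then Suc n else 0)"
      and "b n = (if ok q n then 0 else Suc n)" for n
    have "closed C" unfolding C_def by (rule closed_subsets_class)
    have a: "{n. n + 1 \<in> range a} = {n. ok q n}" and b: "{n. n + 1 \<in> range b} = {n. \<not> ok q n}"
      by (auto simp: a_def b_def image_iff split: if_splits)
    have "names_pos w a C"
      unfolding names_pos_def a using \<open>closed C\<close> ok by auto
    \<comment> \<open>The complement of \<open>C\<close> is open, hence a union of cylinders, all of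
      which are listed.\<close>
    moreover have "x \<in> (\<Union>n\<in>{n. \<not> ok q n}. cylinder (w n))" if x: "x \<notin> C" for x
    proof -
      obtain u where "x \<in> cylinder u" "cylinder u \<subseteq> - C"
        using open_contains_cylinder[OF open_Compl[OF \<open>closed C\<close>], of x] x
        unfolding Compl_iff by metis
      moreover obtain n where "u = w n" using surj by auto
      ultimately show ?thesis using ok by auto
    qed
    then have "names_neg w b C"
      unfolding names_neg_def b using ok by blast
    moreover have "K q = baire_pair a b"
      by (rule ext) (auto simp: K_def baire_pair_def a_def b_def)
    ultimately have "rep_closed w (K q) = Some C"
      unfolding rep_closed_eq_Some_iff names_full_def by blast
    moreover have "rep_cantor (H r) = Some (SORT x)" if "names_enat r (VCdim C)" for r
      using names_enat_le_iff[OF that]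
      by (auto simp: rep_cantor_eq_Some_iff H_def SORT_iff C_def VCdim_subsets_class)
    ultimately show "\<exists>u. in_rep (VCdim_problem w) (K q) = Some u \<and>
      mv (VCdim_problem w) u \<noteq> {} \<and>
      (\<forall>q v. out_rep (VCdim_problem w) q = Some v \<and> v \<in> mv (VCdim_problem w) u \<longrightarrow>
        (\<exists>y\<in>mv SORT_problem x. out_rep SORT_problem (H q) = Some y))"
      by (auto simp: VCdim_problem_def SORT_problem_def rep_enat_eq_Some_iff)
  qed
qed

section \<open>VC dimension of positively given classes reduces to sorting\<close>

definition support :: "bool list \<Rightarrow> nat set" where
  "support u = {i. i < length u \<and> u ! i}"

text \<open>For \<open>w a\<close> of length at most \<open>s\<close>, the word \<open>w b\<close>
  codes a subset of \<open>support (w a)\<close> at the same length, and entry \<open>j\<close> of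
  the name confirms it by listing a cylinder that agrees with \<open>w b\<close> on that support.
  Lengths are compared through end markers, up to position \<open>s\<close> inclusive because a word
  of length \<open>s\<close> has its first marker there.\<close>

definition pattern_seen :: "(nat \<Rightarrow> bool list) \<Rightarrow> baire \<Rightarrow> nat \<Rightarrow> nat \<Rightarrow> nat \<Rightarrow> bool" where
  "pattern_seen w p s a b \<longleftrightarrow> (\<exists>j<s. \<not> p j = 0 \<and> (\<forall>i<Suc s.
     (letter (w b) i = 2 \<longleftrightarrow> letter (w a) i = 2) \<and> (letter (w b) i = 1 \<longrightarrow> letter (w a) i = 1) \<and>
     (letter (w a) i = 1 \<longrightarrow> letter (w (p j - 1)) i = letter (w b) i)))"

text \<open>
  The word \<open>w a\<close> stands for the finite set \<open>support (w a)\<close>. The condition \<open>letter (w a) s = 2\<close> says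
  that \<open>w a\<close> has length at most \<open>s\<close>, which makes all searches bounded by \<open>s\<close>. The index of a word is
  no bound for the indices of the words of the same length, so instead of checking all patterns the
  confirmed ones are counted.
\<close>

definition shattering_seen :: "(nat \<Rightarrow> bool list) \<Rightarrow> baire \<Rightarrow> nat \<Rightarrow> nat \<Rightarrow> bool" where
  "shattering_seen w p s k \<longleftrightarrow> (\<exists>a<s. letter (w a) s = 2 \<and>
     card {i. i < s \<and> letter (w a) i = 1} = k \<and> card {b. b < s \<and> pattern_seen w p s a b} = 2 ^ k)"

text \<open>The counter rises by at most one per stage, even if a much larger set is already
  confirmed, so that each rise can be recorded as a single zero.\<close>

definition dim_seen :: "(nat \<Rightarrow> bool list) \<Rightarrow> baire \<Rightarrow> nat \<Rightarrow> nat" where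
  "dim_seen w p s = rec_nat 0 (\<lambda>t d. if shattering_seen w p t (Suc d) then Suc d else d) s"

section \<open>Confirmed patterns and shattered sets\<close>

lemma letter_eq_iff:
  "letter u i = 2 \<longleftrightarrow> length u \<le> i" "letter u i = 1 \<longleftrightarrow> i \<in> support u"
  by (auto simp: letter_def support_def)

lemma letter_eqD: "i < length v \<Longrightarrow> letter u i = letter v i \<Longrightarrow> i < length u \<and> u ! i = v ! i"
  by (cases "u ! i"; cases "v ! i"; cases "i < length u") (simp_all add: letter_def)

lemma support_inject: "length u = length v \<Longrightarrow> support u = support v \<Longrightarrow> u = v"
  by (rule nth_equalityI) (auto simp: support_def set_eq_iff)

lemma pattern_seen_iff:
  assumes "length (w a) \<le> s"
  shows "pattern_seen w p s a b \<longleftrightarrow> (\<exists>j<s. p j \<noteq> 0 \<and> length (w b) = length (w a) \<and>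
    support (w b) \<subseteq> support (w a) \<and>
    (\<forall>i\<in>support (w a). letter (w (p j - 1)) i = letter (w b) i))"
proof -
  have lt: "i < length u" if "i \<in> support u" for i u
    using that by (simp add: support_def)
  have "(\<forall>i<Suc s. (length (w b) \<le> i \<longleftrightarrow> length (w a) \<le> i) \<and>
      (i \<in> support (w b) \<longrightarrow> i \<in> support (w a)) \<and>
      (i \<in> support (w a) \<longrightarrow> letter (w m) i = letter (w b) i)) \<longleftrightarrow>
    length (w b) = length (w a) \<and> support (w b) \<subseteq> support (w a) \<and>
      (\<forall>i\<in>support (w a). letter (w m) i = letter (w b) i)" (is "?l \<longleftrightarrow> ?r") for m
  proof
    assume l: ?l
    \<comment> \<open>Position \<open>length (w a)\<close> is in the tested range and bounds the
      length of \<open>w b\<close>; so \<open>length (w b)\<close> is in range as well and gives the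
      converse.\<close>
    then have ba: "length (w b) \<le> length (w a)" using assms by simp
    then have "length (w b) < Suc s" using assms by simp
    then have "length (w a) \<le> length (w b)" using l by blast
    with ba have "length (w b) = length (w a)" by (rule antisym)
    moreover have "i < Suc s" if "i \<in> support (w a) \<or> i \<in> support (w b)" for i
      using that lt[of i "w a"] lt[of i "w b"] assms ba by linarith
    ultimately show ?r using l by blast
  qed auto
  then show ?thesis
    unfolding pattern_seen_def letter_eq_iff by simp
qed

text \<open>Patterns confirmed for \<open>a\<close> have a common length, so the support determines
  the word and, as \<open>w\<close> is injective, its index. Counting indices is thus counting
  subsets of \<open>support (w a)\<close>.\<close>

lemma patterns_seen_inj:
  assumes "inj w" "length (w a) \<le> s"
  shows "inj_on (\<lambda>b. support (w b)) {b. b < s \<and> pattern_seen w p s a b}"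
    and "(\<lambda>b. support (w b)) ` {b. b < s \<and> pattern_seen w p s a b} \<subseteq> Pow (support (w a))"
proof -
  have seen: "length (w b) = length (w a) \<and> support (w b) \<subseteq> support (w a)"
    if "pattern_seen w p s a b" for b
    using that unfolding pattern_seen_iff[where w = w, OF assms(2)] by blast
  show "inj_on (\<lambda>b. support (w b)) {b. b < s \<and> pattern_seen w p s a b}"
  proof (rule inj_onI)
    fix b c
    assume "b \<in> {b. b < s \<and> pattern_seen w p s a b}" "c \<in> {b. b < s \<and> pattern_seen w p s a b}"
      and eq: "support (w b) = support (w c)"
    then have "length (w b) = length (w c)" using seen by simp
    then have "w b = w c" using eq by (rule support_inject)
    then show "b = c" using assms(1) by (simp add: inj_eq)
  qed
  show "(\<lambda>b. support (w b)) ` {b. b < s \<and> pattern_seen w p s a b} \<subseteq> Pow (support (w a))"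
    using seen by blast
qed

lemma finite_support: "finite (support u)"
  by (simp add: support_def)

lemma support_eq_letters: "length u \<le> s \<Longrightarrow> {i. i < s \<and> letter u i = 1} = support u"
  unfolding letter_eq_iff by (auto simp: support_def)

text \<open>An injection of \<open>2 ^ k\<close> patterns into the power set of a
  \<open>k\<close>-element set is onto, and the cylinder confirming a pattern contains a point of
  \<open>C\<close> that realizes it.\<close>

lemma shattering_seen_sound:
  assumes "inj w" "names_pos w p C" "shattering_seen w p s k"
  shows "\<exists>A. finite A \<and> card A = k \<and> shattered C A"
proof -
  obtain a where len: "length (w a) \<le> s" and k: "card (support (w a)) = k"
    and card: "card {b. b < s \<and> pattern_seen w p s a b} = 2 ^ k"
    using assms(3) unfolding shattering_seen_def letter_eq_iff(1)
    using support_eq_letters by metis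
  let ?A = "support (w a)"
  have onto: "(\<lambda>b. support (w b)) ` {b. b < s \<and> pattern_seen w p s a b} = Pow ?A"
    using patterns_seen_inj[OF assms(1) len, of p] card k
    by (intro card_subset_eq) (auto simp: card_image card_Pow finite_support)
  have "\<exists>x\<in>C. {n. x n} \<inter> ?A = B" if "B \<subseteq> ?A" for B
  proof -
    from that have "B \<in> (\<lambda>b. support (w b)) ` {b. b < s \<and> pattern_seen w p s a b}"
      unfolding onto by simp
    then obtain b j where B: "B = support (w b)" "length (w b) = length (w a)" "p j \<noteq> 0"
      and eq: "\<And>i. i \<in> ?A \<Longrightarrow> letter (w (p j - 1)) i = letter (w b) i"
      unfolding pattern_seen_iff[where w = w, OF len] by blast
    have "p j - 1 + 1 = p j" using B(3) by simp
    then have "p j - 1 + 1 \<in> range p" by (metis rangeI)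
    then obtain x where x: "x \<in> C" "x \<in> cylinder (w (p j - 1))"
      using assms(2) unfolding names_pos_def by blast
    have "x i \<longleftrightarrow> i \<in> B" if "i \<in> ?A" for i
    proof -
      have i: "i < length (w b)" using that B(2) by (simp add: support_def)
      then have "i < length (w (p j - 1)) \<and> w (p j - 1) ! i = w b ! i"
        using eq[OF that] by (rule letter_eqD)
      then show ?thesis using x(2) i unfolding B(1) by (simp add: cylinder_def support_def)
    qed
    then have "{n. x n} \<inter> ?A = B" using that by auto
    then show ?thesis using x(1) by blast
  qed
  then have "shattered C ?A" unfolding shattered_iff[OF finite_support] by blast
  then show ?thesis using k finite_support by blast
qed

text \<open>Finitely many patterns need one entry of the name each. All late stages are covered
  because the counter may become ready for this size only late.\<close>

lemma shattering_seen_complete: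
  assumes "bij w" "names_pos w p C" "finite A" "shattered C A"
  shows "\<exists>s0. \<forall>s\<ge>s0. shattering_seen w p s (card A)"
proof -
  obtain l where l: "\<And>i. i \<in> A \<Longrightarrow> i < l"
    using assms(3) finite_nat_set_iff_bounded by auto
  \<comment> \<open>The index of the characteristic word of \<open>B\<close> below \<open>l\<close>,
    a bound for \<open>A\<close>.\<close>
  define idx where "idx B = inv w (map (\<lambda>i. i \<in> B) [0..<l])" for B
  have w_idx: "w (idx B) = map (\<lambda>i. i \<in> B) [0..<l]" for B
    unfolding idx_def using assms(1) by (simp add: bij_is_surj surj_f_inv_f)
  have len: "length (w (idx B)) = l" for B by (simp add: w_idx)
  have supp: "support (w (idx B)) = B" if "B \<subseteq> A" for B
    using that l by (auto simp: w_idx support_def)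
  have "\<exists>j. p j \<noteq> 0 \<and> (\<forall>i\<in>A. letter (w (p j - 1)) i = letter (w (idx B)) i)" if B: "B \<subseteq> A" for B
  proof -
    obtain x where x: "x \<in> C" "{n. x n} \<inter> A = B"
      using B assms(4) unfolding shattered_iff[OF assms(3)] by blast
    \<comment> \<open>The first \<open>l\<close> values of \<open>x\<close> fix its trace on
      \<open>A\<close>, and their cylinder meets \<open>C\<close> in \<open>x\<close>.\<close>
    obtain m where m: "w m = map x [0..<l]"
      using assms(1) by (metis bij_pointE)
    have "x \<in> cylinder (w m)" by (simp add: m cylinder_def)
    then have "m + 1 \<in> range p" using x(1) assms(2) unfolding names_pos_def by blast
    then obtain j where "p j = Suc m" by auto
    then show ?thesis
      using x(2) l by (intro exI[of _ j]) (auto simp: m w_idx letter_def)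
  qed
  then obtain J where J: "\<And>B. B \<subseteq> A \<Longrightarrow> p (J B) \<noteq> 0"
    "\<And>B i. B \<subseteq> A \<Longrightarrow> i \<in> A \<Longrightarrow> letter (w (p (J B) - 1)) i = letter (w (idx B)) i"
    by metis
  \<comment> \<open>The sum is a common bound for all indices \<open>idx B\<close> and all positions
    \<open>J B\<close> of confirming entries.\<close>
  define s0 where "s0 = Suc (l + (\<Sum>B\<in>Pow A. idx B + J B))"
  have s0: "l \<le> s0" "idx B < s0" "J B < s0" if "B \<subseteq> A" for B
    using member_le_sum[of B "Pow A" "\<lambda>B. idx B + J B"] that assms(3) by (auto simp: s0_def)
  have "shattering_seen w p s (card A)" if s: "s0 \<le> s" for s
  proof -
    let ?M = "{b. b < s \<and> pattern_seen w p s (idx A) b}"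
    have l_s: "length (w (idx A)) \<le> s" using s0(1)[of A] s len by simp
    \<comment> \<open>The count must be exact: distinct patterns give distinct subsets of
      \<open>A\<close>, and each subset gives a pattern.\<close>
    have "card ?M \<le> card (Pow A)"
      using patterns_seen_inj[OF bij_is_inj[OF assms(1)] l_s, of p] assms(3)
      unfolding supp[OF subset_refl] by (intro card_inj_on_le) auto
    moreover have "card (Pow A) \<le> card ?M"
    proof (rule card_inj_on_le)
      show "inj_on idx (Pow A)" by (intro inj_onI) (metis PowD supp)
      show "idx ` Pow A \<subseteq> ?M"
      proof safe
        fix B assume B: "B \<subseteq> A"
        show "idx B < s" using s0(2)[OF B] s by simp
        show "pattern_seen w p s (idx A) (idx B)"
          unfolding pattern_seen_iff[where w = w, OF l_s] supp[OF B] supp[OF subset_refl] len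
          using s0(3)[OF B] s J[OF B] B by (intro exI[of _ "J B"]) simp
      qed
    qed simp
    ultimately have "card ?M = 2 ^ card A" using assms(3) by (simp add: card_Pow)
    then show ?thesis
      unfolding shattering_seen_def letter_eq_iff(1)
      using l_s s0(2)[of A] s support_eq_letters[OF l_s] supp[of A]
      by (intro exI[of _ "idx A"]) auto
  qed
  then show ?thesis by blast
qed

section \<open>Stagewise lower bounds for the dimension\<close>

lemma oracle_rec_dim_seen:
  assumes w: "computable_word_enumeration w"
  shows "oracle_dec (Suc (Suc 0)) (\<lambda>p xs. shattering_seen w p (hd xs) (hd (tl xs)))"
    and "oracle_rec (Suc 0) (\<lambda>p xs. dim_seen w p (hd xs))"
proof -
  let ?seen = "\<lambda>p s k. of_bool (shattering_seen w p s k) :: nat"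
  \<comment> \<open>Two nested bounded quantifiers add four entries to the three arguments, so seven
    variables occur.\<close>
  have pattern: "oracle_dec k (\<lambda>p xs. pattern_seen w p (s p xs) (a p xs) (b p xs))"
    if "oracle_rec k s" "oracle_rec k a" "oracle_rec k b" for k s a b
    by (rule oracle_rec_compose3[OF _ that, where f = "\<lambda>p s a b. of_bool (pattern_seen w p s a b)"])
       (unfold pattern_seen_def, intro oracle_rec_intros oracle_rec_letter w)
  show *: "oracle_dec (Suc (Suc 0)) (\<lambda>p xs. shattering_seen w p (hd xs) (hd (tl xs)))"
    unfolding shattering_seen_def by (intro oracle_rec_intros oracle_rec_letter pattern w)
  show "oracle_rec (Suc 0) (\<lambda>p xs. dim_seen w p (hd xs))"
    unfolding dim_seen_def
    by (intro oracle_rec_intros oracle_rec_compose2[where f = ?seen, OF *])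
qed

lemma dim_seen_Suc:
  "dim_seen w p (Suc s) =
    (if shattering_seen w p s (Suc (dim_seen w p s)) then Suc (dim_seen w p s) else dim_seen w p s)"
  by (simp add: dim_seen_def)

lemma mono_dim_seen: "s \<le> t \<Longrightarrow> dim_seen w p s \<le> dim_seen w p t"
  by (rule lift_Suc_mono_le[of "dim_seen w p"]) (simp add: dim_seen_Suc)

text \<open>By soundness the counter never exceeds the dimension. It cannot get stuck below it,
  since a set one larger than its value is confirmed at all late stages.\<close>

lemma enat_le_VCdim_iff_dim_seen:
  assumes "bij w" "names_pos w p C"
  shows "enat k \<le> VCdim C \<longleftrightarrow> (\<exists>s. k \<le> dim_seen w p s)"
proof
  have "enat (dim_seen w p s) \<le> VCdim C" for s
  proof (induction s)
    case (Suc s)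
    then show ?case
      using shattering_seen_sound[OF bij_is_inj[OF assms(1)] assms(2), of s]
      by (auto simp: dim_seen_Suc enat_le_VCdim_iff)
  qed (simp add: dim_seen_def flip: zero_enat_def)
  then show "\<exists>s. k \<le> dim_seen w p s \<Longrightarrow> enat k \<le> VCdim C"
    by (meson enat_ord_simps(1) order_trans)
  show "enat k \<le> VCdim C \<Longrightarrow> \<exists>s. k \<le> dim_seen w p s"
  proof (induction k)
    case (Suc k)
    obtain s where s: "k \<le> dim_seen w p s"
      using Suc by (meson enat_ord_simps(1) le_SucI order_refl order_trans)
    obtain A where A: "finite A" "card A = Suc k" "shattered C A"
      using Suc.prems enat_le_VCdim_iff[of "Suc k" C] by auto
    obtain s0 where s0: "\<And>t. s0 \<le> t \<Longrightarrow> shattering_seen w p t (Suc k)"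
      using shattering_seen_complete[OF assms A(1,3)] A(2) by auto
    \<comment> \<open>At this stage the counter is at least \<open>k\<close> and a set of size
      \<open>Suc k\<close> is confirmed, so it has passed \<open>k\<close> or rises now.\<close>
    let ?t = "max s s0"
    have "k \<le> dim_seen w p ?t" using s mono_dim_seen[of s ?t w p] by simp
    then have "Suc k \<le> dim_seen w p (Suc ?t)"
      using s0[of ?t] by (cases "dim_seen w p ?t = k") (auto simp: dim_seen_Suc)
    then show ?case by blast
  qed simp
qed

lemma VCdim_pos_le_SORT:
  assumes w: "computable_word_enumeration w" shows "VCdim_pos_problem w \<le>\<^sub>s\<^sub>W SORT_problem"
proof (rule sW_le_totalI)
  have bij: "bij w" using w by (simp add: computable_word_enumeration_def)
  \<comment> \<open>A zero is written exactly at the stages where \<open>dim_seen\<close>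
    rises.\<close>
  define x where "x p s \<longleftrightarrow> \<not> shattering_seen w p s (Suc (dim_seen w p s))" for p s
  show "oracle_rec (Suc 0) (\<lambda>p xs. p (hd xs))"
    by (intro oracle_rec_intros)
  show "oracle_rec (Suc 0) (\<lambda>p xs. of_bool (x p (hd xs)))"
    unfolding x_def
    by (intro oracle_rec_intros oracle_rec_dim_seen w
        oracle_rec_compose2[where f = "\<lambda>p s k. of_bool (shattering_seen w p s k)",
          OF oracle_rec_dim_seen(1)])
  fix p C assume "in_rep (VCdim_pos_problem w) p = Some C"
  then have p: "names_pos w p C"
    using bij by (simp add: VCdim_pos_problem_def rep_closed_pos_eq_Some_iff bij_is_surj)
  have card: "card {i. i < s \<and> \<not> x p i} = dim_seen w p s" for s
  proof (induction s)
    case (Suc s)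
    have "{i. i < Suc s \<and> \<not> x p i} = {i. i < s \<and> \<not> x p i} \<union> (if x p s then {} else {s})"
      by (auto simp: less_Suc_eq)
    then show ?case using Suc by (simp add: dim_seen_Suc x_def)
  qed (simp add: dim_seen_def)
  have "VCdim C = ecard {i. \<not> x p i}"
  proof (rule enat_eqI_positive)
    fix k
    have "(\<exists>s. k \<le> dim_seen w p s) \<longleftrightarrow> enat k \<le> ecard {i. \<not> x p i}"
      unfolding enat_le_ecard_iff
    proof
      assume "\<exists>s. k \<le> dim_seen w p s"
      then obtain s where "k \<le> card {i. i < s \<and> \<not> x p i}" by (auto simp: card)
      then obtain T where "T \<subseteq> {i. i < s \<and> \<not> x p i}" "card T = k" "finite T"
        by (rule obtain_subset_with_card_n)
      then show "\<exists>T\<subseteq>{i. \<not> x p i}. finite T \<and> card T = k" by blast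
    next
      assume "\<exists>T\<subseteq>{i. \<not> x p i}. finite T \<and> card T = k"
      then obtain T where T: "T \<subseteq> {i. \<not> x p i}" "finite T" "card T = k" by blast
      \<comment> \<open>Finitely many zeros lie in an initial segment, whose zeros
        \<open>dim_seen\<close> counts.\<close>
      obtain s where "\<And>i. i \<in> T \<Longrightarrow> i < s" using T(2) finite_nat_set_iff_bounded by auto
      then have "k \<le> card {i. i < s \<and> \<not> x p i}"
        using T(1) unfolding T(3)[symmetric] by (intro card_mono) auto
      then show "\<exists>s. k \<le> dim_seen w p s" by (auto simp: card)
    qed
    then show "enat k \<le> VCdim C \<longleftrightarrow> enat k \<le> ecard {i. \<not> x p i}"
      unfolding enat_le_VCdim_iff_dim_seen[OF bij p] .
  qed
  then show "\<exists>u. in_rep SORT_problem (\<lambda>s. of_bool (x p s)) = Some u \<and>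
      mv SORT_problem u \<noteq> {} \<and>
      (\<forall>q v. out_rep SORT_problem q = Some v \<and> v \<in> mv SORT_problem u \<longrightarrow>
        (\<exists>y\<in>mv (VCdim_pos_problem w) C. out_rep (VCdim_pos_problem w) q = Some y))"
    using names_enat_SORT[of "x p"]
    by (auto simp: SORT_problem_def VCdim_pos_problem_def rep_cantor_eq_Some_iff
        rep_enat_eq_Some_iff)
qed

theorem theorem27:
  fixes w :: "nat \<Rightarrow> bool list"
  assumes "computable_word_enumeration w"
  shows "VCdim_problem w \<equiv>\<^sub>s\<^sub>W VCdim_pos_problem w \<and> VCdim_pos_problem w \<equiv>\<^sub>s\<^sub>W SORT_problem"
proof -
  have 1: "VCdim_problem w \<le>\<^sub>s\<^sub>W VCdim_pos_problem w"
    using assms by (intro VCdim_le_VCdim_pos) (auto simp: computable_word_enumeration_def bij_def)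
  note 2 = VCdim_pos_le_SORT[OF assms] and 3 = SORT_le_VCdim[OF assms]
  show ?thesis
    unfolding sW_equiv_def using 1 2 3 sW_le_trans[OF 2 3] sW_le_trans[OF 3 1] by blast
qed

end
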